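(* Let $C\in\mathbb{R}^{(m+p)\times n}$, let $P\in\mathbb{S}_+^n$ be factorized as $P=Q^TQ$, where $Q\in\mathbb{R}^{q\times n}$ has rank $q$, and assume that $QC^TCQ^T\in\mathbb{S}_{++}^q$. Then a matrix $D$ with $(D^TD)^{-1}\in\mathcal{L}$ that minimizes the ratio $$\frac{\lambda_1(DCPC^TD^T)}{\lambda_r(DCPC^TD^T)}$$ over all invertible $D\in\mathbb{R}^{(m+p)\times(m+p)}$ with $(D^TD)^{-1}\in\mathcal{L}$ can be computed by solving the semi-definite program, in the variables $t\in\mathbb{R}$ and $M$, $$\text{minimize } -t\quad\text{subject to}\quad QC^TMCQ^T\preceq I,\quad QC^TMCQ^T\succeq tI,\quad M\in\mathcal{L},$$ where $M=D^TD$; that is, if $(t,M)$ is an optimal solution of this program and $D$ is invertible with $M=D^TD$, then $D$ minimizes the ratio. Further, $\mathbf{L}=(D^TD)^{-1}\succeq CPC^T$.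
   Context: $\mathbb{S}_+^k$ and $\mathbb{S}_{++}^k$ are the sets of symmetric positive semidefinite, respectively positive definite, real $k\times k$ matrices; $L\succeq M$ (equivalently $M\preceq L$) means $L-M$ is symmetric positive semidefinite. $\lambda_1(X)$ and $\lambda_r(X)$ denote the largest and the smallest non-zero eigenvalue of a symmetric positive semidefinite matrix $X$. The set $\mathcal{L}$ encodes a sparsity structure: given a set $\mathbb{L}\subseteq\{1,\dots,m+p\}^2$ of index pairs, $$\mathcal{L}=\{\mathbf{L}\in\mathbb{S}_{++}^{m+p}:\ \mathbf{L}=(D^TD)^{-1}\text{ for some invertible }D\in\mathbb{R}^{(m+p)\times(m+p)}\text{ with }\mathbf{L}_{ij}=[\mathbf{L}^{-1}]_{ij}=[D^{-1}]_{ij}=0\text{ if }(i,j)\notin\mathbb{L}\}.$$ Here $\mathbb{L}$ is one of the patterns diagonal ($\mathbb{L}=\{(i,i)\}$), block-diagonal (pairs $(i,j)$ lying in a common block of a partition of $\{1,\dots,m+p\}$), or full (all pairs). *)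

theory Defs
  imports "HOL-Analysis.Analysis" "HOL-Library.Disjoint_Sets"
begin

definition psd :: "real^'k^'k \<Rightarrow> bool" where
  "psd A \<longleftrightarrow> transpose A = A \<and> (\<forall>x. 0 \<le> x \<bullet> (A *v x))"

definition pos_def :: "real^'k^'k \<Rightarrow> bool" where
  "pos_def A \<longleftrightarrow> transpose A = A \<and> (\<forall>x. x \<noteq> 0 \<longrightarrow> 0 < x \<bullet> (A *v x))"

definition loewner_le :: "real^'k^'k \<Rightarrow> real^'k^'k \<Rightarrow> bool"  (infix "\<preceq>\<^sub>L" 50) where
  "M \<preceq>\<^sub>L L \<longleftrightarrow> psd (L - M)"

definition eigenvalues :: "real^'k^'k \<Rightarrow> real set" where
  "eigenvalues X = {c. \<exists>v. v \<noteq> 0 \<and> X *v v = c *\<^sub>R v}"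

definition lambda_max :: "real^'k^'k \<Rightarrow> real" where
  "lambda_max X = Max (eigenvalues X)"

(* Meaningful for symmetric psd matrices (finitely many eigenvalues, all real)
   other than the zero matrix, which has no non-zero eigenvalue. *)
definition lambda_min_nz :: "real^'k^'k \<Rightarrow> real" where
  "lambda_min_nz X = Min (eigenvalues X - {0})"

definition block_pattern :: "'k set set \<Rightarrow> ('k \<times> 'k) set" where
  "block_pattern B = (\<Union>b\<in>B. b \<times> b)"

(* Diagonal, block-diagonal or full; blocks need not consist of consecutive indices. *)
definition sparsity_pattern :: "('k \<times> 'k) set \<Rightarrow> bool" where
  "sparsity_pattern S \<longleftrightarrow>
     S = {(i, j). i = j} \<or> (\<exists>B. partition_on UNIV B \<and> S = block_pattern B) \<or> S = UNIV"

definition structured :: "('k \<times> 'k) set \<Rightarrow> (real^'k^'k) set" where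
  "structured S =
     {L. pos_def L \<and>
         (\<exists>D. invertible D \<and> L = matrix_inv (transpose D ** D) \<and>
              (\<forall>i j. (i, j) \<notin> S \<longrightarrow>
                 L $ i $ j = 0 \<and> matrix_inv L $ i $ j = 0 \<and> matrix_inv D $ i $ j = 0))}"

definition admissible :: "('k \<times> 'k) set \<Rightarrow> real^'k^'k \<Rightarrow> bool" where
  "admissible S D \<longleftrightarrow> invertible D \<and> matrix_inv (transpose D ** D) \<in> structured S"

definition eig_ratio :: "real^'n^'k \<Rightarrow> real^'n^'n \<Rightarrow> real^'k^'k \<Rightarrow> real" where
  "eig_ratio C P D =
     lambda_max (D ** C ** P ** transpose C ** transpose D) /
     lambda_min_nz (D ** C ** P ** transpose C ** transpose D)"

definition sdp_feasible ::
  "real^'n^'k \<Rightarrow> real^'n^'q \<Rightarrow> ('k \<times> 'k) set \<Rightarrow> real \<times> (real^'k^'k) \<Rightarrow> bool" where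
  "sdp_feasible C Q S = (\<lambda>(t, M).
     Q ** transpose C ** M ** C ** transpose Q \<preceq>\<^sub>L mat 1 \<and>
     t *\<^sub>R mat 1 \<preceq>\<^sub>L Q ** transpose C ** M ** C ** transpose Q \<and>
     M \<in> structured S)"

end

theory Submission
  imports Defs
begin

text \<open>
  Write \<open>A = D C Q\<^sup>T\<close>. Then \<open>D C P C\<^sup>T D\<^sup>T = A A\<^sup>T\<close> and \<open>Q C\<^sup>T M C Q\<^sup>T = A\<^sup>T A\<close> for
  \<open>M = D\<^sup>T D\<close>. The two products have the same non-zero eigenvalues, and \<open>A\<^sup>T A\<close> is positive
  definite because \<open>C Q\<^sup>T\<close> is injective. The ratio to be minimized is therefore the condition
  number of \<open>Y(M) = Q C\<^sup>T M C Q\<^sup>T\<close> (\<open>eig_ratio_eq_condition_number\<close>), and bounds on the extreme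
  eigenvalues of \<open>Y(M)\<close> are Loewner inequalities with multiples of the identity
  (\<open>Max_eigenvalues_le_iff\<close>, \<open>le_Min_eigenvalues_iff\<close>).

  The condition number is invariant under scaling of \<open>M\<close>. A competitor \<open>E\<close> can thus be normalized
  so that the largest eigenvalue of \<open>Y\<close> is 1; its smallest eigenvalue is then the reciprocal of
  the ratio of \<open>E\<close>, and the pair of this reciprocal and the normalized matrix is feasible for the
  program. Optimality gives that \<open>t\<close> is at least this reciprocal, in particular positive. Conversely,
  feasibility of \<open>(t, M)\<close> bounds the ratio of \<open>D\<close> by \<open>1 / t\<close>.

  The competitors satisfy \<open>(D\<^sup>T D)\<^sup>-\<^sup>1 \<in> \<L>\<close>, whereas the program asks for \<open>D\<^sup>T D \<in> \<L>\<close>.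
  The two conditions agree because \<open>\<L>\<close> is closed under inversion (\<open>matrix_inv_structured\<close>), which
  rests on the fact that the inverse of a block-diagonal matrix is block-diagonal.

  The last claim is \<open>A A\<^sup>T \<preceq> I\<close>, conjugated by \<open>D\<^sup>-\<^sup>1\<close>; it follows from \<open>A\<^sup>T A \<preceq> I\<close> since a
  matrix and its transpose have the same operator norm.
\<close>

section \<open>Matrix inverses and quadratic forms\<close>

lemma matrix_inv_right_left:
  fixes A :: "real^'k^'k"
  assumes "invertible A"
  shows "A ** matrix_inv A = mat 1" "matrix_inv A ** A = mat 1"
proof -
  have "A ** matrix_inv A = mat 1 \<and> matrix_inv A ** A = mat 1"
    using assms unfolding invertible_def matrix_inv_def by (rule someI_ex)
  then show "A ** matrix_inv A = mat 1" "matrix_inv A ** A = mat 1" by auto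
qed

lemma invertible_rightI:
  fixes A :: "real^'k^'k"
  assumes "A ** B = mat 1"
  shows "invertible A"
  using assms matrix_left_right_inverse unfolding invertible_def by blast

lemma matrix_inv_eqI:
  fixes A :: "real^'k^'k"
  assumes "A ** B = mat 1"
  shows "matrix_inv A = B"
  by (metis assms invertible_rightI matrix_inv_right_left(2) matrix_mul_assoc matrix_mul_lid
      matrix_mul_rid)

lemma matrix_inv_matrix_inv:
  fixes A :: "real^'k^'k"
  assumes "invertible A"
  shows "matrix_inv (matrix_inv A) = A"
  by (intro matrix_inv_eqI matrix_inv_right_left assms)

lemma transpose_mul_transpose_matrix_inv:
  fixes D :: "real^'k^'k"
  assumes "invertible D"
  shows "transpose D ** transpose (matrix_inv D) = mat 1"
  by (simp add: assms matrix_inv_right_left flip: matrix_transpose_mul)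

lemma matrix_inv_gram:
  fixes D :: "real^'k^'k"
  assumes "invertible D"
  shows "matrix_inv (transpose D ** D) = matrix_inv D ** transpose (matrix_inv D)"
proof (rule matrix_inv_eqI)
  have "transpose D ** D ** (matrix_inv D ** transpose (matrix_inv D)) =
      transpose D ** (D ** matrix_inv D) ** transpose (matrix_inv D)"
    by (simp add: matrix_mul_assoc)
  then show "transpose D ** D ** (matrix_inv D ** transpose (matrix_inv D)) = mat 1"
    by (simp add: assms matrix_inv_right_left transpose_mul_transpose_matrix_inv)
qed

lemma invertible_gram:
  fixes D :: "real^'k^'k"
  assumes "invertible D"
  shows "invertible (transpose D ** D)"
  using assms by (intro invertible_mult transpose_invertible)

lemma inner_transpose_mult:
  fixes A :: "real^'n^'m"
  shows "x \<bullet> (transpose A *v y) = (A *v x) \<bullet> y"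
  by (metis dot_lmul_matrix inner_commute transpose_matrix_vector)

lemma inner_gram:
  fixes A :: "real^'n^'m"
  shows "x \<bullet> ((transpose A ** A) *v x) = (A *v x) \<bullet> (A *v x)"
  by (metis inner_transpose_mult matrix_vector_mul_assoc)

lemma inner_outer_gram:
  fixes A :: "real^'n^'m"
  shows "x \<bullet> ((A ** transpose A) *v x) = (transpose A *v x) \<bullet> (transpose A *v x)"
  using inner_gram[of x "transpose A"] by (simp only: transpose_transpose)

lemma transpose_minus: "transpose (A - B) = transpose A - transpose (B :: real^'n^'m)"
  by (simp add: transpose_def vec_eq_iff)

lemma matrix_uminus_mult_vec: "(- A) *v x = - (A *v x)" for A :: "real^'n^'m"
  using matrix_vector_mult_diff_rdistrib[of 0 A x] by simp

lemma scaleR_mat_1_mult_vec: "(c *\<^sub>R mat 1) *v x = c *\<^sub>R x" for x :: "real^'n"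
  by (simp flip: scaleR_matrix_vector_assoc)

lemma pos_def_gramI:
  fixes A :: "real^'n^'m"
  assumes "\<And>x. A *v x = 0 \<Longrightarrow> x = 0"
  shows "pos_def (transpose A ** A)"
  using assms unfolding pos_def_def
  by (auto simp: matrix_transpose_mul inner_gram simp del: transpose_matrix_vector)

lemma invertible_mult_vec_eq_0:
  fixes D :: "real^'k^'k"
  assumes "invertible D" "D *v x = 0"
  shows "x = 0"
  by (metis assms matrix_inv_right_left(2) matrix_vector_mul_assoc matrix_vector_mul_lid
      matrix_vector_mult_0_right)

lemma loewner_le_iff:
  fixes A B :: "real^'k^'k"
  assumes "transpose A = A" "transpose B = B"
  shows "A \<preceq>\<^sub>L B \<longleftrightarrow> (\<forall>x. x \<bullet> (A *v x) \<le> x \<bullet> (B *v x))"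
  using assms unfolding loewner_le_def psd_def
  by (simp add: transpose_minus matrix_vector_mult_diff_rdistrib inner_diff_right)

lemma loewner_le_scalar_iff:
  fixes A :: "real^'k^'k"
  assumes "transpose A = A"
  shows "A \<preceq>\<^sub>L c *\<^sub>R mat 1 \<longleftrightarrow> (\<forall>x. x \<bullet> (A *v x) \<le> c * (x \<bullet> x))"
    and "c *\<^sub>R mat 1 \<preceq>\<^sub>L A \<longleftrightarrow> (\<forall>x. c * (x \<bullet> x) \<le> x \<bullet> (A *v x))"
  using assms by (simp_all add: loewner_le_iff transpose_scalar scaleR_mat_1_mult_vec)

text \<open>Here \<open>\<parallel>A\<^sup>T x\<parallel>\<^sup>2 = \<langle>A A\<^sup>T x, x\<rangle> \<le> \<parallel>A (A\<^sup>T x)\<parallel> \<parallel>x\<parallel> \<le> \<parallel>A\<^sup>T x\<parallel> \<parallel>x\<parallel>\<close>: a contraction has a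
  contractive transpose.\<close>

lemma transpose_contraction:
  fixes A :: "real^'n^'m"
  assumes "\<And>x. (A *v x) \<bullet> (A *v x) \<le> x \<bullet> x"
  shows "(transpose A *v x) \<bullet> (transpose A *v x) \<le> x \<bullet> x"
proof -
  define w where "w = transpose A *v x"
  have contr: "norm (A *v w) \<le> norm w"
    using assms[of w] by (simp add: norm_le)
  have "norm w * norm w = w \<bullet> w"
    by (simp add: power2_norm_eq_inner flip: power2_eq_square)
  also have "\<dots> = (A *v w) \<bullet> x"
    using inner_transpose_mult[of w A x] by (simp add: w_def del: transpose_matrix_vector)
  also have "\<dots> \<le> norm (A *v w) * norm x"
    by (rule norm_cauchy_schwarz)
  also have "\<dots> \<le> norm w * norm x"
    using contr by (simp add: mult_right_mono)
  finally have "norm w \<le> norm x"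
    by (metis mult_le_cancel_left_pos norm_ge_zero order.order_iff_strict)
  then show ?thesis by (simp add: norm_le w_def del: transpose_matrix_vector)
qed

section \<open>Extreme eigenvalues of symmetric matrices\<close>

text \<open>Going from \<open>v\<close> a small step \<open>- e B v\<close> would otherwise make the form negative: the first-order
  change is \<open>- 2 e \<parallel>B v\<parallel>\<^sup>2\<close>.\<close>

lemma psd_isotropic_imp_kernel:
  fixes B :: "real^'k^'k"
  assumes "psd B" "v \<bullet> (B *v v) = 0"
  shows "B *v v = 0"
proof (rule ccontr)
  assume "B *v v \<noteq> 0"
  define w where "w = B *v v"
  define a where "a = w \<bullet> w"
  define b where "b = w \<bullet> (B *v w)"
  have a: "a > 0" using \<open>B *v v \<noteq> 0\<close> by (simp add: a_def w_def)
  have b: "b \<ge> 0" using assms(1) by (simp add: b_def psd_def)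
  \<comment> \<open>minimizes \<open>e\<^sup>2 b - 2 e a\<close> up to the summand 1, which covers \<open>b = 0\<close>\<close>
  define e where "e = a / (b + 1)"
  have sym: "v \<bullet> (B *v w) = a"
    using assms(1) inner_transpose_mult[of v B w] by (simp add: psd_def a_def w_def)
  have "0 \<le> (v - e *\<^sub>R w) \<bullet> (B *v (v - e *\<^sub>R w))"
    using assms(1) by (simp add: psd_def)
  also have "\<dots> = e * (e * b) - 2 * e * a"
    using assms(2) sym
    by (simp add: matrix_vector_mult_diff_distrib matrix_vector_mult_scaleR inner_diff_left
        inner_diff_right right_diff_distrib a_def b_def flip: w_def)
  finally have "e * (2 * a) \<le> e * (e * b)" by simp
  moreover have "e > 0" using a b by (simp add: e_def)
  ultimately have "2 * a \<le> e * b" by simp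
  moreover have "e * b \<le> a" using a b by (simp add: e_def field_simps)
  ultimately show False using a by simp
qed

text \<open>The maximum of the quadratic form over the unit sphere is an eigenvalue: if it is \<open>\<mu>\<close> and is
  attained at \<open>v\<close>, then \<open>\<mu> I - A\<close> is positive semidefinite and its form vanishes at \<open>v\<close>.\<close>

lemma rayleigh_maximum:
  fixes A :: "real^'k^'k"
  assumes "transpose A = A"
  shows "\<exists>\<mu>\<in>eigenvalues A. \<forall>x. x \<bullet> (A *v x) \<le> \<mu> * (x \<bullet> x)"
proof -
  let ?f = "\<lambda>x. x \<bullet> (A *v x)"
  have "axis undefined 1 \<in> sphere (0::real^'k) 1" by simp
  then have "sphere (0::real^'k) 1 \<noteq> {}" by blast
  moreover have "continuous_on (sphere 0 1) ?f"
    by (intro continuous_intros linear_continuous_on_compose[OF continuous_on_id]) simp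
  ultimately obtain v where v: "v \<in> sphere 0 1" "\<And>u. u \<in> sphere 0 1 \<Longrightarrow> ?f u \<le> ?f v"
    using continuous_attains_sup[OF compact_sphere] by blast
  define \<mu> where "\<mu> = ?f v"
  have v1: "v \<bullet> v = 1" using v(1) by (simp add: norm_eq_1)
  have bound: "?f x \<le> \<mu> * (x \<bullet> x)" for x
  proof (cases "x = 0")
    case False
    then have "inverse (norm x) *\<^sub>R x \<in> sphere 0 1" by simp
    then have "?f (inverse (norm x) *\<^sub>R x) \<le> \<mu>" unfolding \<mu>_def by (rule v(2))
    then have "?f x / (norm x)\<^sup>2 \<le> \<mu>"
      by (simp add: matrix_vector_mult_scaleR field_simps power2_eq_square)
    then show ?thesis using False by (simp add: field_simps power2_norm_eq_inner)
  qed simp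
  have "psd (\<mu> *\<^sub>R mat 1 - A)"
    using bound assms by (simp add: loewner_le_scalar_iff flip: loewner_le_def)
  moreover have "v \<bullet> ((\<mu> *\<^sub>R mat 1 - A) *v v) = 0"
    by (simp add: matrix_vector_mult_diff_rdistrib scaleR_mat_1_mult_vec inner_diff_right v1 \<mu>_def)
  ultimately have "(\<mu> *\<^sub>R mat 1 - A) *v v = 0" by (rule psd_isotropic_imp_kernel)
  then have "A *v v = \<mu> *\<^sub>R v"
    by (simp add: matrix_vector_mult_diff_rdistrib scaleR_mat_1_mult_vec)
  moreover have "v \<noteq> 0" using v1 by auto
  ultimately have "\<mu> \<in> eigenvalues A" by (auto simp: eigenvalues_def)
  with bound show ?thesis by blast
qed

lemma rayleigh_minimum:
  fixes A :: "real^'k^'k"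
  assumes "transpose A = A"
  shows "\<exists>\<mu>\<in>eigenvalues A. \<forall>x. \<mu> * (x \<bullet> x) \<le> x \<bullet> (A *v x)"
proof -
  have "transpose (- A) = - A" using assms by (simp add: transpose_def vec_eq_iff)
  from rayleigh_maximum[OF this] obtain \<mu> where
    \<mu>: "\<mu> \<in> eigenvalues (- A)" "\<And>x. x \<bullet> ((- A) *v x) \<le> \<mu> * (x \<bullet> x)" by blast
  obtain v where "v \<noteq> 0" "- (A *v v) = \<mu> *\<^sub>R v"
    using \<mu>(1) by (auto simp: eigenvalues_def matrix_uminus_mult_vec)
  then have "- \<mu> \<in> eigenvalues A"
    unfolding eigenvalues_def by (auto intro!: exI[of _ v] simp: minus_equation_iff[of "A *v v"])
  moreover have "- \<mu> * (x \<bullet> x) \<le> x \<bullet> (A *v x)" for x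
    using \<mu>(2)[of x] by (simp add: matrix_uminus_mult_vec)
  ultimately show ?thesis by blast
qed

lemma eigenvalue_quadratic_form:
  fixes A :: "real^'k^'k"
  assumes "c \<in> eigenvalues A"
  shows "\<exists>v. 0 < v \<bullet> v \<and> v \<bullet> (A *v v) = c * (v \<bullet> v)"
proof -
  obtain v where "v \<noteq> 0" "A *v v = c *\<^sub>R v"
    using assms by (auto simp: eigenvalues_def)
  then show ?thesis by (intro exI[of _ v]) simp
qed

text \<open>Eigenvectors for distinct eigenvalues are orthogonal, so a choice of one eigenvector for each
  eigenvalue is an independent set.\<close>

lemma finite_eigenvalues:
  fixes A :: "real^'k^'k"
  assumes "transpose A = A"
  shows "finite (eigenvalues A)"
proof -
  have "\<forall>c\<in>eigenvalues A. \<exists>v. v \<noteq> 0 \<and> A *v v = c *\<^sub>R v" by (auto simp: eigenvalues_def)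
  then obtain f where f: "\<And>c. c \<in> eigenvalues A \<Longrightarrow> f c \<noteq> 0"
    "\<And>c. c \<in> eigenvalues A \<Longrightarrow> A *v f c = c *\<^sub>R f c" by metis
  have orth: "f c \<bullet> f d = 0" if "c \<in> eigenvalues A" "d \<in> eigenvalues A" "c \<noteq> d" for c d
  proof -
    have "f c \<bullet> (A *v f d) = (A *v f c) \<bullet> f d"
      using inner_transpose_mult[of "f c" A "f d"] assms by simp
    then show ?thesis using that by (simp add: f)
  qed
  have "inj_on f (eigenvalues A)"
    using orth f(1) by (intro inj_onI) (metis inner_eq_zero_iff)
  moreover have "independent (f ` eigenvalues A)"
    using f(1) by (intro pairwise_orthogonal_independent)
      (auto simp: pairwise_def orthogonal_def intro!: orth)
  then have "finite (f ` eigenvalues A)" by (simp add: independent_bound)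
  ultimately show ?thesis by (rule inj_on_finite[OF _ order_refl])
qed

lemma eigenvalues_nonempty:
  fixes A :: "real^'k^'k"
  assumes "transpose A = A"
  shows "eigenvalues A \<noteq> {}"
  using rayleigh_maximum[OF assms] by blast

lemma Max_eigenvalues_le_iff:
  fixes A :: "real^'k^'k"
  assumes "transpose A = A"
  shows "Max (eigenvalues A) \<le> c \<longleftrightarrow> A \<preceq>\<^sub>L c *\<^sub>R mat 1"
proof
  assume "Max (eigenvalues A) \<le> c"
  moreover obtain \<mu> where \<mu>: "\<mu> \<in> eigenvalues A" "\<And>x. x \<bullet> (A *v x) \<le> \<mu> * (x \<bullet> x)"
    using rayleigh_maximum[OF assms] by blast
  ultimately have "\<mu> \<le> c" using finite_eigenvalues[OF assms] Max_ge order_trans by blast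
  then have "\<mu> * (x \<bullet> x) \<le> c * (x \<bullet> x)" for x :: "real^'k" by (simp add: mult_right_mono)
  then show "A \<preceq>\<^sub>L c *\<^sub>R mat 1"
    unfolding loewner_le_scalar_iff[OF assms] using \<mu>(2) order_trans by blast
next
  assume le: "A \<preceq>\<^sub>L c *\<^sub>R mat 1"
  have "d \<le> c" if d: "d \<in> eigenvalues A" for d
  proof -
    obtain v where "0 < v \<bullet> v" "v \<bullet> (A *v v) = d * (v \<bullet> v)"
      using eigenvalue_quadratic_form[OF d] by blast
    then show ?thesis using le assms by (metis loewner_le_scalar_iff(1) mult_le_cancel_right_pos)
  qed
  then show "Max (eigenvalues A) \<le> c"
    by (simp add: assms eigenvalues_nonempty finite_eigenvalues)
qed

lemma le_Min_eigenvalues_iff: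
  fixes A :: "real^'k^'k"
  assumes "transpose A = A"
  shows "c \<le> Min (eigenvalues A) \<longleftrightarrow> c *\<^sub>R mat 1 \<preceq>\<^sub>L A"
proof
  assume "c \<le> Min (eigenvalues A)"
  moreover obtain \<mu> where \<mu>: "\<mu> \<in> eigenvalues A" "\<And>x. \<mu> * (x \<bullet> x) \<le> x \<bullet> (A *v x)"
    using rayleigh_minimum[OF assms] by blast
  ultimately have "c \<le> \<mu>" using finite_eigenvalues[OF assms] Min_le order_trans by blast
  then have "c * (x \<bullet> x) \<le> \<mu> * (x \<bullet> x)" for x :: "real^'k" by (simp add: mult_right_mono)
  then show "c *\<^sub>R mat 1 \<preceq>\<^sub>L A"
    unfolding loewner_le_scalar_iff[OF assms] using \<mu>(2) order_trans by blast
next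
  assume le: "c *\<^sub>R mat 1 \<preceq>\<^sub>L A"
  have "c \<le> d" if d: "d \<in> eigenvalues A" for d
  proof -
    obtain v where "0 < v \<bullet> v" "v \<bullet> (A *v v) = d * (v \<bullet> v)"
      using eigenvalue_quadratic_form[OF d] by blast
    then show ?thesis using le assms by (metis loewner_le_scalar_iff(2) mult_le_cancel_right_pos)
  qed
  then show "c \<le> Min (eigenvalues A)"
    by (simp add: assms eigenvalues_nonempty finite_eigenvalues)
qed

lemma eigenvalues_pos:
  fixes A :: "real^'k^'k"
  assumes "pos_def A" "c \<in> eigenvalues A"
  shows "0 < c"
proof -
  obtain v where v: "0 < v \<bullet> v" "v \<bullet> (A *v v) = c * (v \<bullet> v)"
    using eigenvalue_quadratic_form[OF assms(2)] by blast
  then have "0 < c * (v \<bullet> v)" using assms(1) by (metis inner_gt_zero_iff pos_def_def)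
  then show ?thesis using v(1) by (simp add: zero_less_mult_iff)
qed

text \<open>If \<open>v\<close> is an eigenvector of \<open>A B\<close> for an eigenvalue other than 0, then \<open>B v\<close> is one of
  \<open>B A\<close>.\<close>

lemma nonzero_eigenvalues_mult_subset:
  fixes A :: "real^'n^'m" and B :: "real^'m^'n"
  shows "eigenvalues (A ** B) - {0} \<subseteq> eigenvalues (B ** A)"
proof
  fix c assume c: "c \<in> eigenvalues (A ** B) - {0}"
  then obtain v where v: "v \<noteq> 0" "A *v (B *v v) = c *\<^sub>R v"
    by (auto simp: eigenvalues_def matrix_vector_mul_assoc)
  have "B *v v \<noteq> 0"
    using v c by auto
  moreover have "(B ** A) *v (B *v v) = c *\<^sub>R (B *v v)"
    using v(2) by (metis matrix_vector_mul_assoc matrix_vector_mult_scaleR)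
  ultimately show "c \<in> eigenvalues (B ** A)" by (auto simp: eigenvalues_def)
qed

text \<open>\<open>A A\<^sup>T\<close> may have the additional eigenvalue 0. It is excluded from the minimum by definition, and
  it does not affect the maximum because the eigenvalues of \<open>A\<^sup>T A\<close> are positive.\<close>

lemma lambda_outer_gram:
  fixes A :: "real^'n^'m"
  assumes pd: "pos_def (transpose A ** A)"
  shows "lambda_max (A ** transpose A) = Max (eigenvalues (transpose A ** A))"
    and "lambda_min_nz (A ** transpose A) = Min (eigenvalues (transpose A ** A))"
proof -
  define E where "E = eigenvalues (transpose A ** A)"
  have pos: "\<And>c. c \<in> E \<Longrightarrow> 0 < c" unfolding E_def by (rule eigenvalues_pos[OF pd])
  have fin: "finite E" and ne: "E \<noteq> {}"
    unfolding E_def by (simp_all add: finite_eigenvalues eigenvalues_nonempty matrix_transpose_mul)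
  have "E - {0} \<subseteq> eigenvalues (A ** transpose A)"
    "eigenvalues (A ** transpose A) - {0} \<subseteq> E"
    unfolding E_def by (rule nonzero_eigenvalues_mult_subset)+
  with pos have *: "eigenvalues (A ** transpose A) - {0} = E" by blast
  then show "lambda_min_nz (A ** transpose A) = Min (eigenvalues (transpose A ** A))"
    by (simp add: lambda_min_nz_def E_def)
  have "eigenvalues (A ** transpose A) = E \<or> eigenvalues (A ** transpose A) = insert 0 E"
    using * by blast
  moreover have "Max (insert 0 E) = Max E"
    using fin ne pos Max_in[OF fin ne] by (simp add: max_def not_le order_less_imp_le)
  ultimately show "lambda_max (A ** transpose A) = Max (eigenvalues (transpose A ** A))"
    by (auto simp: lambda_max_def E_def)
qed

section \<open>The structured set\<close>

lemma sparsity_pattern_equiv: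
  assumes "sparsity_pattern S"
  shows "equiv UNIV S"
proof -
  have "equiv UNIV (block_pattern B)" if B: "partition_on UNIV B" for B :: "'a set set"
  proof (rule equivI)
    show "refl (block_pattern B)"
      using partition_onD1[OF B] by (auto simp: refl_on_def block_pattern_def)
    show "sym (block_pattern B)" by (auto simp: sym_def block_pattern_def)
    show "trans (block_pattern B)"
    proof (rule transI)
      fix x y z assume "(x, y) \<in> block_pattern B" "(y, z) \<in> block_pattern B"
      then obtain b c where "b \<in> B" "c \<in> B" "x \<in> b" "y \<in> b" "y \<in> c" "z \<in> c"
        by (auto simp: block_pattern_def)
      moreover from this have "b = c"
        using partition_onD2[OF B] by (meson disjointD disjoint_iff)
      ultimately show "(x, z) \<in> block_pattern B" by (auto simp: block_pattern_def)
    qed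
  qed simp
  moreover have "equiv UNIV {(i, j). i = (j::'a)}"
    by (auto simp: equiv_def refl_on_def sym_def trans_def)
  moreover have "equiv UNIV (UNIV :: ('a \<times> 'a) set)"
    by (auto simp: equiv_def refl_on_def sym_def trans_def)
  ultimately show ?thesis using assms unfolding sparsity_pattern_def by blast
qed

text \<open>A matrix is supported on the pattern exactly if it commutes with the coordinate projection
  onto each equivalence class, and a matrix commuting with \<open>A\<close> commutes with \<open>A\<^sup>-\<^sup>1\<close>.\<close>

lemma matrix_inv_supported:
  fixes A :: "real^'k^'k"
  assumes S: "equiv UNIV S" and inv: "invertible A"
    and supp: "\<And>i j. (i, j) \<notin> S \<Longrightarrow> A $ i $ j = 0"
    and ij: "(i, j) \<notin> S"
  shows "matrix_inv A $ i $ j = 0"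
proof -
  define E :: "real^'k^'k" where "E = (\<chi> a b. if a = b \<and> (i, a) \<in> S then 1 else 0)"
  have right: "(X ** E) $ a $ b = (if (i, b) \<in> S then X $ a $ b else 0)" for X :: "real^'k^'k" and a b
  proof -
    have "(X ** E) $ a $ b = (\<Sum>k\<in>UNIV. if k = b then (if (i, b) \<in> S then X $ a $ b else 0) else 0)"
      unfolding matrix_matrix_mult_def E_def by (simp only: vec_lambda_beta, intro sum.cong) auto
    then show ?thesis by simp
  qed
  have left: "(E ** X) $ a $ b = (if (i, a) \<in> S then X $ a $ b else 0)" for X :: "real^'k^'k" and a b
  proof -
    have "(E ** X) $ a $ b = (\<Sum>k\<in>UNIV. if k = a then (if (i, a) \<in> S then X $ a $ b else 0) else 0)"
      unfolding matrix_matrix_mult_def E_def by (simp only: vec_lambda_beta, intro sum.cong) auto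
    then show ?thesis by simp
  qed
  have sym: "sym S" and trans: "trans S" and refl: "(i, i) \<in> S"
    using S by (auto simp: equiv_def refl_on_def)
  have "A $ a $ b = 0" if "((i, a) \<in> S) \<noteq> ((i, b) \<in> S)" for a b
    using that supp[of a b] sym trans by (meson symD transD)
  then have comm: "A ** E = E ** A"
    by (simp add: vec_eq_iff right left)
  let ?B = "matrix_inv A"
  have "E ** ?B = ?B ** A ** E ** ?B"
    by (simp add: matrix_inv_right_left inv)
  also have "\<dots> = ?B ** (A ** E) ** ?B"
    by (simp add: matrix_mul_assoc)
  also have "\<dots> = ?B ** E ** (A ** ?B)"
    by (simp add: comm matrix_mul_assoc)
  also have "\<dots> = ?B ** E"
    by (simp add: matrix_inv_right_left inv)
  finally have "(E ** ?B) $ i $ j = (?B ** E) $ i $ j" by simp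
  then show ?thesis using ij refl by (simp add: left right)
qed

lemma pos_def_matrix_inv_gram:
  fixes D :: "real^'k^'k"
  assumes "invertible D"
  shows "pos_def (matrix_inv (transpose D ** D))"
proof -
  have "invertible (transpose (matrix_inv D))"
    using assms by (metis invertible_rightI matrix_inv_right_left(2) transpose_invertible)
  then have "pos_def (transpose (transpose (matrix_inv D)) ** transpose (matrix_inv D))"
    using invertible_mult_vec_eq_0 by (intro pos_def_gramI) blast
  then show ?thesis using assms by (simp add: matrix_inv_gram)
qed

text \<open>If \<open>D\<close> is the factor witnessing that \<open>L = (D\<^sup>T D)\<^sup>-\<^sup>1\<close> is structured, then \<open>D\<^sup>-\<^sup>T\<close> is the
  one for \<open>L\<^sup>-\<^sup>1 = D\<^sup>T D\<close>. Its inverse \<open>D\<^sup>T\<close> has the right zeros because \<open>D = (D\<^sup>-\<^sup>1)\<^sup>-\<^sup>1\<close> does.\<close>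

lemma matrix_inv_structured:
  fixes L :: "real^'k^'k"
  assumes S: "equiv UNIV S" and L: "L \<in> structured S"
  shows "matrix_inv L \<in> structured S"
proof -
  obtain D where D: "invertible D" "L = matrix_inv (transpose D ** D)"
    and zero: "\<And>i j. (i, j) \<notin> S \<Longrightarrow>
      L $ i $ j = 0 \<and> matrix_inv L $ i $ j = 0 \<and> matrix_inv D $ i $ j = 0"
    using L by (auto simp: structured_def)
  define F where "F = transpose (matrix_inv D)"
  have invL: "matrix_inv L = transpose D ** D"
    unfolding D(2) using D(1) by (intro matrix_inv_matrix_inv invertible_gram)
  have invinvL: "matrix_inv (matrix_inv L) = L"
    unfolding invL by (rule D(2)[symmetric])
  have FD: "F ** transpose D = mat 1"
    unfolding F_def by (simp add: D(1) matrix_inv_right_left flip: matrix_transpose_mul)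
  have F: "invertible F" "matrix_inv F = transpose D"
    using FD by (rule invertible_rightI, rule matrix_inv_eqI)
  have Linv: "matrix_inv L = matrix_inv (transpose F ** F)"
    using F by (simp add: matrix_inv_gram invL)
  have invD: "invertible (matrix_inv D)"
    using D(1) by (metis invertible_rightI matrix_inv_right_left(2))
  have "matrix_inv F $ i $ j = 0" if "(i, j) \<notin> S" for i j
  proof -
    have "(j, i) \<notin> S" using that S by (auto simp: equiv_def dest: symD)
    then have "matrix_inv (matrix_inv D) $ j $ i = 0"
      using matrix_inv_supported[OF S invD] zero by blast
    then show ?thesis by (simp add: F D(1) matrix_inv_matrix_inv transpose_def)
  qed
  moreover have "pos_def (matrix_inv L)"
    unfolding Linv by (rule pos_def_matrix_inv_gram[OF F(1)])
  ultimately show ?thesis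
    unfolding structured_def using F(1) Linv zero invinvL by auto
qed

lemma scaleR_structured:
  fixes L :: "real^'k^'k"
  assumes c: "0 < c" and L: "L \<in> structured S"
  shows "c *\<^sub>R L \<in> structured S"
proof -
  obtain D where D: "invertible D" "L = matrix_inv (transpose D ** D)"
    and zero: "\<And>i j. (i, j) \<notin> S \<Longrightarrow>
      L $ i $ j = 0 \<and> matrix_inv L $ i $ j = 0 \<and> matrix_inv D $ i $ j = 0"
    using L by (auto simp: structured_def)
  define F where "F = (1 / sqrt c) *\<^sub>R D"
  have "F ** (sqrt c *\<^sub>R matrix_inv D) = mat 1"
    using c D(1) by (simp add: F_def matrix_scalar_ac matrix_inv_right_left flip: scalar_matrix_assoc)
  then have F: "invertible F" "matrix_inv F = sqrt c *\<^sub>R matrix_inv D"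
    by (rule invertible_rightI, rule matrix_inv_eqI)
  have cL: "c *\<^sub>R L = matrix_inv (transpose F ** F)"
    using F D c by (simp add: matrix_inv_gram transpose_scalar matrix_scalar_ac flip: scalar_matrix_assoc)
  have "L ** matrix_inv L = mat 1"
    unfolding D(2) using D(1)
    by (simp add: invertible_gram matrix_inv_matrix_inv matrix_inv_right_left)
  then have "matrix_inv (c *\<^sub>R L) = (1 / c) *\<^sub>R matrix_inv L"
    using c by (intro matrix_inv_eqI) (simp add: matrix_scalar_ac flip: scalar_matrix_assoc)
  then have "(c *\<^sub>R L) $ i $ j = 0 \<and> matrix_inv (c *\<^sub>R L) $ i $ j = 0 \<and> matrix_inv F $ i $ j = 0"
    if "(i, j) \<notin> S" for i j
    using zero[OF that] by (simp add: F(2))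
  moreover have "pos_def (c *\<^sub>R L)"
    unfolding cL by (rule pos_def_matrix_inv_gram[OF F(1)])
  ultimately show ?thesis
    unfolding structured_def using F(1) cL by blast
qed

lemma admissible_iff_gram_structured:
  fixes D :: "real^'k^'k"
  assumes S: "equiv UNIV S"
  shows "admissible S D \<longleftrightarrow> invertible D \<and> transpose D ** D \<in> structured S"
  using matrix_inv_structured[OF S] matrix_inv_matrix_inv[OF invertible_gram]
  unfolding admissible_def by metis

section \<open>The ratio as a condition number\<close>

definition compression :: "real^'n^'k \<Rightarrow> real^'n^'q \<Rightarrow> real^'k^'k \<Rightarrow> real^'q^'q" where
  "compression C Q M = Q ** transpose C ** M ** C ** transpose Q"

lemma compression_gram:
  fixes C :: "real^'n^'k" and Q :: "real^'n^'q" and D :: "real^'k^'k"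
  shows
  "compression C Q (transpose D ** D) = transpose (D ** C ** transpose Q) ** (D ** C ** transpose Q)"
  by (simp add: compression_def matrix_transpose_mul matrix_mul_assoc)

lemma compression_scaleR: "compression C Q (c *\<^sub>R M) = c *\<^sub>R compression C Q M"
  by (simp add: compression_def matrix_scalar_ac flip: scalar_matrix_assoc)

lemma pos_def_compression_gram:
  fixes C :: "real^'n^'k" and Q :: "real^'n^'q" and D :: "real^'k^'k"
  assumes pd: "pos_def (Q ** transpose C ** C ** transpose Q)" and D: "invertible D"
  shows "pos_def (compression C Q (transpose D ** D))"
  unfolding compression_gram
proof (rule pos_def_gramI)
  fix x assume "(D ** C ** transpose Q) *v x = 0"
  then have "D *v ((C ** transpose Q) *v x) = 0"
    by (simp add: matrix_vector_mul_assoc matrix_mul_assoc del: transpose_matrix_vector)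
  then have 0: "(C ** transpose Q) *v x = 0" by (rule invertible_mult_vec_eq_0[OF D])
  have "Q ** transpose C ** C ** transpose Q = transpose (C ** transpose Q) ** (C ** transpose Q)"
    by (simp add: matrix_transpose_mul matrix_mul_assoc)
  then have "x \<bullet> ((Q ** transpose C ** C ** transpose Q) *v x) = 0"
    using inner_gram[of x "C ** transpose Q"] 0 by simp
  then show "x = 0" using pd by (force simp: pos_def_def)
qed

lemma eig_ratio_eq_condition_number:
  fixes C :: "real^'n^'k" and P :: "real^'n^'n" and Q :: "real^'n^'q" and D :: "real^'k^'k"
  assumes "P = transpose Q ** Q" "pos_def (compression C Q (transpose D ** D))"
  shows "eig_ratio C P D = Max (eigenvalues (compression C Q (transpose D ** D))) /
    Min (eigenvalues (compression C Q (transpose D ** D)))"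
proof -
  have "D ** C ** P ** transpose C ** transpose D =
      (D ** C ** transpose Q) ** transpose (D ** C ** transpose Q)"
    by (simp add: assms(1) matrix_transpose_mul matrix_mul_assoc)
  then show ?thesis
    using lambda_outer_gram[of "D ** C ** transpose Q"] assms(2)
    by (simp add: eig_ratio_def compression_gram)
qed

text \<open>Scaling a competitor \<open>E\<close> so that the largest eigenvalue of the compression is 1 turns it into
  a feasible point with objective value \<open>- 1 / eig_ratio C P E\<close>.\<close>

lemma competitor_feasible:
  fixes C :: "real^'n^'k" and P :: "real^'n^'n" and Q :: "real^'n^'q" and E :: "real^'k^'k"
  assumes S: "equiv UNIV S" and P: "P = transpose Q ** Q"
    and pd: "pos_def (compression C Q (transpose E ** E))" and E: "admissible S E"
  shows "\<exists>N. sdp_feasible C Q S (1 / eig_ratio C P E, N)" and "0 < eig_ratio C P E"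
proof -
  define Y where "Y = compression C Q (transpose E ** E)"
  define a where "a = Max (eigenvalues Y)"
  define b where "b = Min (eigenvalues Y)"
  have Y: "transpose Y = Y" using pd by (simp add: Y_def pos_def_def)
  have a: "0 < a" and b: "0 < b"
    unfolding a_def b_def using pd Y
    by (auto simp: finite_eigenvalues eigenvalues_nonempty Y_def intro!: eigenvalues_pos[of Y])
  have ratio: "eig_ratio C P E = a / b"
    unfolding a_def b_def Y_def by (rule eig_ratio_eq_condition_number[OF P pd])
  then show "0 < eig_ratio C P E" using a b by simp
  define N where "N = (1 / a) *\<^sub>R (transpose E ** E)"
  have N: "compression C Q N = (1 / a) *\<^sub>R Y" by (simp add: N_def Y_def compression_scaleR)
  have symN: "transpose ((1 / a) *\<^sub>R Y) = (1 / a) *\<^sub>R Y" by (simp add: transpose_scalar Y)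
  have upper: "x \<bullet> (Y *v x) \<le> a * (x \<bullet> x)" and lower: "b * (x \<bullet> x) \<le> x \<bullet> (Y *v x)" for x
    using Max_eigenvalues_le_iff[OF Y, of a] le_Min_eigenvalues_iff[OF Y, of b]
    by (simp_all add: a_def b_def loewner_le_scalar_iff[OF Y])
  have "compression C Q N \<preceq>\<^sub>L 1 *\<^sub>R mat 1"
    unfolding N loewner_le_scalar_iff[OF symN] using upper a
    by (simp add: field_simps flip: scaleR_matrix_vector_assoc)
  moreover have "(1 / eig_ratio C P E) *\<^sub>R mat 1 \<preceq>\<^sub>L compression C Q N"
    unfolding N loewner_le_scalar_iff[OF symN] ratio using lower a
    by (simp add: field_simps flip: scaleR_matrix_vector_assoc)
  moreover have "N \<in> structured S"
    unfolding N_def using a E S by (simp add: scaleR_structured admissible_iff_gram_structured)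
  ultimately show "\<exists>N. sdp_feasible C Q S (1 / eig_ratio C P E, N)"
    by (auto simp: sdp_feasible_def compression_def)
qed

lemma eig_ratio_le_inverse_bound:
  fixes C :: "real^'n^'k" and P :: "real^'n^'n" and Q :: "real^'n^'q" and D :: "real^'k^'k"
  assumes P: "P = transpose Q ** Q" and pd: "pos_def (compression C Q (transpose D ** D))"
    and upper: "compression C Q (transpose D ** D) \<preceq>\<^sub>L mat 1"
    and lower: "t *\<^sub>R mat 1 \<preceq>\<^sub>L compression C Q (transpose D ** D)" and t: "0 < t"
  shows "eig_ratio C P D \<le> 1 / t"
proof -
  have Y: "transpose (compression C Q (transpose D ** D)) = compression C Q (transpose D ** D)"
    using pd by (simp add: pos_def_def)
  show ?thesis
    unfolding eig_ratio_eq_condition_number[OF P pd]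
    using upper lower t Max_eigenvalues_le_iff[OF Y, of 1] le_Min_eigenvalues_iff[OF Y, of t]
    by (intro frac_le) auto
qed

text \<open>The bound says that \<open>A = D C Q\<^sup>T\<close> is a contraction, hence so is \<open>A\<^sup>T\<close>. Evaluating the latter
  at \<open>D\<^sup>-\<^sup>T x\<close> gives the quadratic form of \<open>C P C\<^sup>T\<close> at \<open>x\<close> on the left and that of
  \<open>(D\<^sup>T D)\<^sup>-\<^sup>1\<close> on the right.\<close>

lemma outer_le_matrix_inv_gram:
  fixes C :: "real^'n^'k" and P :: "real^'n^'n" and Q :: "real^'n^'q" and D :: "real^'k^'k"
  assumes P: "P = transpose Q ** Q" and D: "invertible D"
    and le: "compression C Q (transpose D ** D) \<preceq>\<^sub>L mat 1"
  shows "C ** P ** transpose C \<preceq>\<^sub>L matrix_inv (transpose D ** D)"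
proof -
  define A where "A = D ** C ** transpose Q"
  define G where "G = matrix_inv D"
  have gram: "transpose (transpose A ** A) = transpose A ** A"
    by (simp add: matrix_transpose_mul)
  have "transpose A ** A \<preceq>\<^sub>L 1 *\<^sub>R mat 1"
    using le by (simp add: compression_gram A_def)
  then have contr: "(A *v x) \<bullet> (A *v x) \<le> x \<bullet> x" for x
    unfolding loewner_le_scalar_iff[OF gram] inner_gram by simp
  have GA: "G ** A = C ** transpose Q"
    using D by (simp add: A_def G_def matrix_mul_assoc matrix_inv_right_left)
  then have CPC: "C ** P ** transpose C = (G ** A) ** transpose (G ** A)"
    by (simp add: P matrix_transpose_mul matrix_mul_assoc)
  have inv: "matrix_inv (transpose D ** D) = G ** transpose G"
    using D by (simp add: matrix_inv_gram G_def)
  have "transpose (G ** A) *v x = transpose A *v (transpose G *v x)" for x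
    by (simp add: matrix_transpose_mul matrix_vector_mul_assoc del: transpose_matrix_vector)
  then have "x \<bullet> ((G ** A ** transpose (G ** A)) *v x) \<le> x \<bullet> ((G ** transpose G) *v x)" for x
    using transpose_contraction[OF contr] by (simp only: inner_outer_gram)
  then show ?thesis
    unfolding CPC inv by (subst loewner_le_iff) (simp_all add: matrix_transpose_mul matrix_mul_assoc)
qed

theorem proposition25:
  fixes C :: "real^'n^'k" and P :: "real^'n^'n" and Q :: "real^'n^'q"
    and S :: "('k \<times> 'k) set"
    and t :: real and M D :: "real^'k^'k"
  assumes "sparsity_pattern S"
    and "psd P"
    and "P = transpose Q ** Q"
    and "rank Q = CARD('q)"
    and "pos_def (Q ** transpose C ** C ** transpose Q)"
    and "is_arg_min (\<lambda>(t, M). - t) (sdp_feasible C Q S) (t, M)"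
    and "invertible D"
    and "M = transpose D ** D"
  shows "is_arg_min (eig_ratio C P) (admissible S) D \<and>
    C ** P ** transpose C \<preceq>\<^sub>L matrix_inv (transpose D ** D)"
proof
  have S: "equiv UNIV S" using assms(1) by (rule sparsity_pattern_equiv)
  have pd: "pos_def (compression C Q (transpose E ** E))" if "invertible E" for E :: "real^'k^'k"
    using assms(5) that by (rule pos_def_compression_gram)
  have feasible: "compression C Q (transpose D ** D) \<preceq>\<^sub>L mat 1"
    "t *\<^sub>R mat 1 \<preceq>\<^sub>L compression C Q (transpose D ** D)" "transpose D ** D \<in> structured S"
    using assms(6,8) by (auto simp: is_arg_min_def sdp_feasible_def compression_def)
  have optimal: "s \<le> t" if "sdp_feasible C Q S (s, N)" for s N
    using assms(6) that by (force simp: is_arg_min_def)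
  have "eig_ratio C P D \<le> eig_ratio C P E" if E: "admissible S E" for E
  proof -
    have pdE: "pos_def (compression C Q (transpose E ** E))"
      using E pd by (simp add: admissible_def)
    note competitor = competitor_feasible[OF S assms(3) pdE E]
    have le: "1 / eig_ratio C P E \<le> t" using competitor(1) optimal by blast
    moreover have "0 < 1 / eig_ratio C P E" using competitor(2) by simp
    ultimately have t: "0 < t" by linarith
    have "eig_ratio C P D \<le> 1 / t"
      by (rule eig_ratio_le_inverse_bound[OF assms(3) pd[OF assms(7)] feasible(1,2) t])
    also have "\<dots> \<le> eig_ratio C P E"
      using le t competitor(2) by (simp add: field_simps)
    finally show ?thesis .
  qed
  moreover have "admissible S D"
    using assms(7) feasible(3) by (simp add: admissible_iff_gram_structured[OF S])
  ultimately show "is_arg_min (eig_ratio C P) (admissible S) D"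
    by (auto simp: is_arg_min_def not_less)
  show "C ** P ** transpose C \<preceq>\<^sub>L matrix_inv (transpose D ** D)"
    using assms(3,7) feasible(1) by (rule outer_le_matrix_inv_gram)
qed

end
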